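(* Let $m\in\mathbb N$ and let $\tau_M\ge 0$ be an integer. Let $(\Omega,\mathcal F,\mathbb P)$ be a probability space with a filtration $\{\mathcal F^{t}\}_{t\ge 0}$ and let $\{\sigma^{t}\}_{t\ge 0}$ be a stochastic process with state space $S$, adapted to $\{\mathcal F^{t}\}$. For $\tau=0,1,\dots,\tau_M$ let $G^{\tau}(\cdot)$ map $S$ to nonnegative $m\times m$ matrices, such that $G^{\tau}(\sigma^{t})$ is $\mathcal F^{t}$-measurable for every $t$, and such that $G(\sigma):=\sum_{\tau=0}^{\tau_M}G^{\tau}(\sigma)$ is a stochastic matrix for every $\sigma\in S$. Consider the delayed multi-agent system $$x_i^{t+1}=\sum_{\tau=0}^{\tau_M}\sum_{j=1}^{m}G^{\tau}_{ij}(\sigma^{t})\,x_j^{t-\tau},\qquad i=1,\dots,m,\quad t=0,1,2,\dots$$ Suppose there exist $\mu>0$, $L\in\mathbb N$ and $\delta>0$ such that $G^{0}(\sigma)\ge\mu I_m$ (entrywise) for all $\sigma\in S$ and, almost surely, for all $n\in\mathbb N$ the $\delta$-graph of $$\mathbb E\Big\{\sum_{k=n+1}^{n+L}G(\sigma^{k})\,\Big|\,\mathcal F^{n}\Big\}$$ has a spanning tree. Then the delayed multi-agent system reaches consensus.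
   Context: $\mathbb N$ is the set of positive integers. A stochastic matrix is a square matrix with nonnegative entries and all row sums equal to $1$. Matrix inequalities are entrywise. Graph of a nonnegative matrix $A\in\mathbb R^{m,m}$: the directed graph on vertices $1,\dots,m$ with a link from $j$ to $i$ if and only if $A_{ij}>0$ (self-links allowed). A graph has a spanning tree if some vertex can access every other vertex along a directed path. For $\delta>0$ the $\delta$-matrix of $A$ has $(i,j)$ entry $\delta$ if $A_{ij}\ge\delta$ and $0$ otherwise; the $\delta$-graph of $A$ is the graph of its $\delta$-matrix. Reaching consensus: for all essentially bounded random initial data $x^{-\tau}\in\mathbb R^{m}$, $\tau=0,1,\dots,\tau_M$, and almost every sequence $\{\sigma^{t}\}$ there exists $\alpha\in\mathbb R$ such that $\lim_{t\to\infty}x^{t}=\alpha\mathbf 1$, where $\mathbf 1=[1,\dots,1]^{\top}$. *)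

theory Defs
  imports "HOL-Probability.Probability"
begin

text \<open>Matrices are of type \<^typ>\<open>real ^ 'n ^ 'n\<close>; the index type \<^typ>\<open>'n::finite\<close> plays
  the role of the set of the \<open>m\<close> agents. The order on such matrices is the entrywise one.\<close>

definition stochastic_matrix :: "real ^ 'n ^ 'n \<Rightarrow> bool" where
  "stochastic_matrix A \<longleftrightarrow> 0 \<le> A \<and> (\<forall>i. (\<Sum>j\<in>UNIV. A $ i $ j) = 1)"

text \<open>Links go from column to row index: the pair \<open>(j, i)\<close> is a link iff \<open>A $ i $ j > 0\<close>.\<close>

definition matrix_graph :: "real ^ 'n ^ 'n \<Rightarrow> 'n rel" where
  "matrix_graph A = {(j, i). A $ i $ j > 0}"

definition has_spanning_tree :: "'n rel \<Rightarrow> bool" where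
  "has_spanning_tree E \<longleftrightarrow> (\<exists>r. \<forall>v. v \<noteq> r \<longrightarrow> (r, v) \<in> E\<^sup>+)"

definition delta_matrix :: "real \<Rightarrow> real ^ 'n ^ 'n \<Rightarrow> real ^ 'n ^ 'n" where
  "delta_matrix \<delta> A = (\<chi> i j. if A $ i $ j \<ge> \<delta> then \<delta> else 0)"

definition delta_graph :: "real \<Rightarrow> real ^ 'n ^ 'n \<Rightarrow> 'n rel" where
  "delta_graph \<delta> A = matrix_graph (delta_matrix \<delta> A)"

definition matrix_cond_exp ::
  "'a measure \<Rightarrow> 'a measure \<Rightarrow> ('a \<Rightarrow> real ^ 'n ^ 'n) \<Rightarrow> 'a \<Rightarrow> real ^ 'n ^ 'n" where
  "matrix_cond_exp M F A = (\<lambda>\<omega>. \<chi> i j. real_cond_exp M F (\<lambda>\<omega>'. A \<omega>' $ i $ j) \<omega>)"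

definition ess_bounded :: "'a measure \<Rightarrow> ('a \<Rightarrow> 'b::real_normed_vector) \<Rightarrow> bool" where
  "ess_bounded M f \<longleftrightarrow> (\<exists>C. AE \<omega> in M. norm (f \<omega>) \<le> C)"

text \<open>Trajectories are indexed by \<^typ>\<open>int\<close>. The initial data are the values at the times
  \<open>- \<tau>\<close> for \<open>\<tau> \<le> \<tau>M\<close>; values at earlier times do not enter.\<close>

definition delayed_system ::
  "'a measure \<Rightarrow> nat \<Rightarrow> (nat \<Rightarrow> 's \<Rightarrow> real ^ 'n ^ 'n) \<Rightarrow> (nat \<Rightarrow> 'a \<Rightarrow> 's) \<Rightarrow>
    (int \<Rightarrow> 'a \<Rightarrow> real ^ 'n) \<Rightarrow> bool" where
  "delayed_system M \<tau>M G \<sigma> x \<longleftrightarrow>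
    (\<forall>\<omega>\<in>space M. \<forall>t::nat. \<forall>i. x (int t + 1) \<omega> $ i =
      (\<Sum>\<tau>\<le>\<tau>M. \<Sum>j\<in>UNIV. G \<tau> (\<sigma> t \<omega>) $ i $ j * x (int t - int \<tau>) \<omega> $ j))"

text \<open>The consensus value \<open>\<alpha>\<close> may depend on the realization \<open>\<omega>\<close> and on the initial data.
  The initial data are arbitrary random vectors on the underlying space; no measurability
  with respect to a smaller sigma-algebra is imposed.\<close>

definition reaches_consensus ::
  "'a measure \<Rightarrow> nat \<Rightarrow> (nat \<Rightarrow> 's \<Rightarrow> real ^ 'n ^ 'n) \<Rightarrow> (nat \<Rightarrow> 'a \<Rightarrow> 's) \<Rightarrow> bool" where
  "reaches_consensus M \<tau>M G \<sigma> \<longleftrightarrow>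
    (\<forall>x. (\<forall>\<tau>\<le>\<tau>M. x (- int \<tau>) \<in> borel_measurable M \<and> ess_bounded M (x (- int \<tau>))) \<longrightarrow>
      delayed_system M \<tau>M G \<sigma> x \<longrightarrow>
      (AE \<omega> in M. \<exists>\<alpha>::real. (\<lambda>t::nat. x (int t) \<omega>) \<longlonglongrightarrow> \<alpha> *\<^sub>R 1))"

end

theory Submission
  imports Defs
begin

text \<open>Over a window of delay length, let \<open>U\<close> and \<open>V\<close> be the largest and the smallest value and
  \<open>D = U - V\<close>. Call an agent low if it stays a fixed fraction of \<open>D\<close> below \<open>U\<close>, and high if it
  stays that far above \<open>V\<close>. Every agent is initially low or high, and both properties survive
  (with a smaller fraction) because the undelayed diagonal weight is at least \<open>\<mu>\<close>. The root of a
  spanning tree is low or high, so unless all agents are low or all are high, some link of the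
  tree leaves the low set or the high set; with conditional probability bounded below such a
  link appears in the next \<open>L\<close> steps and enlarges that set. After as many blocks as there are
  agents one of the sets is everything, and \<open>D\<close> has contracted by a fixed factor. Hence the
  expectation of \<open>D\<close> decays geometrically, and \<open>D\<close>, being monotone, vanishes almost surely in
  the limit.

  Since general initial data need not be measurable with respect to the filtration, the argument
  runs for deterministic unit initial data; the system being linear in its initial data,
  superposition gives the general case.\<close>

subsection \<open>Deterministic averaging with delays\<close>

lemma delta_graph_eq:
  assumes "\<delta> > 0"
  shows "delta_graph \<delta> A = {(j, i). \<delta> \<le> A $ i $ j}"
  using assms by (auto simp: delta_graph_def matrix_graph_def delta_matrix_def)

text \<open>The root lies in \<open>X\<close> or in \<open>Y\<close> because they cover everything.
  A set that contains the root and misses some vertex is left by a link on the path from the root to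
  that vertex.\<close>

lemma spanning_tree_leaves_cover:
  assumes "has_spanning_tree E" "X \<union> Y = UNIV" "X \<noteq> UNIV" "Y \<noteq> UNIV"
  shows "\<exists>(j, i)\<in>E. j \<in> X \<and> i \<notin> X \<or> j \<in> Y \<and> i \<notin> Y"
proof -
  obtain r where r: "\<And>v. v \<noteq> r \<Longrightarrow> (r, v) \<in> E\<^sup>+"
    using assms(1) by (auto simp: has_spanning_tree_def)
  have leave: "\<exists>(j, i)\<in>E. j \<in> Q \<and> i \<notin> Q" if "r \<in> Q" "Q \<noteq> UNIV" for Q
  proof (rule ccontr)
    assume closed: "\<not> ?thesis"
    obtain v where v: "v \<notin> Q" using \<open>Q \<noteq> UNIV\<close> by auto
    with r \<open>r \<in> Q\<close> have "(r, v) \<in> E\<^sup>+" by metis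
    then have "v \<in> Q"
      by (induction rule: trancl_induct) (use closed \<open>r \<in> Q\<close> in blast)+
    with v show False ..
  qed
  have "r \<in> X \<or> r \<in> Y" using assms(2) by auto
  then show ?thesis using leave[of X] leave[of Y] assms(3,4) by blast
qed

section \<open>Extreme values over a window of delay length\<close>

definition window_max :: "nat \<Rightarrow> (nat \<Rightarrow> real ^ 'n) \<Rightarrow> nat \<Rightarrow> real" where
  "window_max d y t = Max ((\<lambda>p. y (fst p) $ snd p) ` ({t..d + t} \<times> UNIV))"

definition window_min :: "nat \<Rightarrow> (nat \<Rightarrow> real ^ 'n) \<Rightarrow> nat \<Rightarrow> real" where
  "window_min d y t = Min ((\<lambda>p. y (fst p) $ snd p) ` ({t..d + t} \<times> UNIV))"

text \<open>The window \<open>{t..d + t}\<close> holds exactly the values that enter the computation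
  of \<open>y (Suc (d + t))\<close>.\<close>

definition spread :: "nat \<Rightarrow> (nat \<Rightarrow> real ^ 'n) \<Rightarrow> nat \<Rightarrow> real" where
  "spread d y t = window_max d y t - window_min d y t"

lemma window_max_ge: "t \<le> s \<Longrightarrow> s \<le> d + t \<Longrightarrow> y s $ i \<le> window_max d y t"
  unfolding window_max_def by (rule Max_ge) force+

lemma window_min_le: "t \<le> s \<Longrightarrow> s \<le> d + t \<Longrightarrow> window_min d y t \<le> y s $ i"
  unfolding window_min_def by (rule Min_le) force+

lemma window_max_le:
  assumes "\<And>s i. t \<le> s \<Longrightarrow> s \<le> d + t \<Longrightarrow> y s $ i \<le> U"
  shows "window_max d y t \<le> U"
  unfolding window_max_def using assms by (subst Max_le_iff) auto

lemma window_min_ge: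
  assumes "\<And>s i. t \<le> s \<Longrightarrow> s \<le> d + t \<Longrightarrow> V \<le> y s $ i"
  shows "V \<le> window_min d y t"
  unfolding window_min_def using assms by (subst Min_ge_iff) auto

lemma spread_nonneg: "0 \<le> spread d y t"
proof -
  have "window_min d y t \<le> y t $ i" "y t $ i \<le> window_max d y t" for i
    by (auto intro: window_min_le window_max_ge)
  then show ?thesis unfolding spread_def by (meson diff_ge_0_iff_ge order_trans)
qed

text \<open>The trajectory is shifted by the maximal delay: \<open>y (d + t)\<close> is the state at time \<open>t\<close>.\<close>

locale delayed_averaging =
  fixes A :: "nat \<Rightarrow> nat \<Rightarrow> real ^ 'n ^ 'n" and d :: nat and \<mu> :: real
    and y :: "nat \<Rightarrow> real ^ 'n"
  assumes nonneg: "\<tau> \<le> d \<Longrightarrow> 0 \<le> A \<tau> t $ i $ j"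
    and row_sum: "(\<Sum>\<tau>\<le>d. \<Sum>j\<in>UNIV. A \<tau> t $ i $ j) = 1"
    and diag: "\<mu> \<le> A 0 t $ i $ i"
    and mu_pos: "0 < \<mu>"
    and rec: "y (Suc (d + t)) $ i = (\<Sum>\<tau>\<le>d. \<Sum>j\<in>UNIV. A \<tau> t $ i $ j * y (d + t - \<tau>) $ j)"
begin

text \<open>The axioms are invariant under a change of sign, so every upper bound proved below
  yields the matching lower bound.\<close>

lemma neg: "delayed_averaging A d \<mu> (\<lambda>s. - y s)"
  by unfold_locales
    (use nonneg row_sum diag mu_pos in \<open>auto simp: rec sum_negf\<close>)

section \<open>One averaging step and the propagation of gaps\<close>

lemma entry_le_row_part:
  assumes "\<tau> \<le> d" "\<And>\<tau> j. \<tau> \<le> d \<Longrightarrow> 0 \<le> f \<tau> j"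
  shows "A \<tau> t $ i $ j * f \<tau> j \<le> (\<Sum>\<tau>\<le>d. \<Sum>j\<in>UNIV. A \<tau> t $ i $ j * (f \<tau> j :: real))"
proof -
  have "A \<tau> t $ i $ j * f \<tau> j \<le> (\<Sum>j\<in>UNIV. A \<tau> t $ i $ j * f \<tau> j)"
    using assms nonneg by (intro member_le_sum) auto
  also have "\<dots> \<le> (\<Sum>\<tau>\<le>d. \<Sum>j\<in>UNIV. A \<tau> t $ i $ j * f \<tau> j)"
    using assms nonneg
    by (intro member_le_sum[where f = "\<lambda>\<tau>. \<Sum>j\<in>UNIV. A \<tau> t $ i $ j * f \<tau> j"] sum_nonneg) auto
  finally show ?thesis .
qed

lemma entry_le_1: "\<tau> \<le> d \<Longrightarrow> A \<tau> t $ i $ j \<le> 1"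
  using entry_le_row_part[of \<tau> "\<lambda>_ _. 1" t i j] by (simp add: row_sum)

lemma mu_le_1: "\<mu> \<le> 1"
  using diag entry_le_1[of 0] by (meson le0 order_trans)

text \<open>The weights sum to 1, so the new distance to \<open>U\<close> is the weighted average of
  the old distances. These are all nonnegative, and a single term of the average is a lower
  bound.\<close>

lemma step_gap:
  assumes "\<And>s j. t \<le> s \<Longrightarrow> s \<le> d + t \<Longrightarrow> y s $ j \<le> U"
    and "\<tau> \<le> d" "y (d + t - \<tau>) $ j \<le> U - c" "0 \<le> c" "\<beta> \<le> A \<tau> t $ i $ j"
  shows "y (Suc (d + t)) $ i \<le> U - \<beta> * c"
proof -
  have "U - y (Suc (d + t)) $ i = (\<Sum>\<tau>\<le>d. \<Sum>j\<in>UNIV. A \<tau> t $ i $ j) * U - y (Suc (d + t)) $ i"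
    by (simp add: row_sum)
  also have "\<dots> = (\<Sum>\<tau>\<le>d. \<Sum>j\<in>UNIV. A \<tau> t $ i $ j * (U - y (d + t - \<tau>) $ j))"
    by (simp add: rec sum_distrib_right right_diff_distrib sum_subtractf)
  also have "\<dots> \<ge> A \<tau> t $ i $ j * (U - y (d + t - \<tau>) $ j)"
    using assms(1,2) by (intro entry_le_row_part) auto
  also have "A \<tau> t $ i $ j * (U - y (d + t - \<tau>) $ j) \<ge> A \<tau> t $ i $ j * c"
    using assms nonneg by (intro mult_left_mono) auto
  also have "A \<tau> t $ i $ j * c \<ge> \<beta> * c"
    using assms by (intro mult_right_mono) auto
  finally show ?thesis by simp
qed

lemma bounded_above_from:
  assumes "\<And>s j. t \<le> s \<Longrightarrow> s \<le> d + t \<Longrightarrow> y s $ j \<le> U" and "t \<le> s"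
  shows "y s $ i \<le> U"
  using \<open>t \<le> s\<close>
proof (induction s arbitrary: i rule: less_induct)
  case (less s)
  show ?case
  proof (cases "s \<le> d + t")
    case False
    then obtain r where r: "s = Suc (d + (t + r))"
      by (metis add.assoc add_Suc_right less_imp_Suc_add not_le)
    \<comment> \<open>With gap 0 the one-step estimate only says that an average of values below
      \<open>U\<close> stays below \<open>U\<close>.\<close>
    have "y (Suc (d + (t + r))) $ i \<le> U - \<mu> * 0"
      by (rule step_gap[where \<tau> = 0 and j = i])
        (use less.IH r diag in \<open>auto\<close>)
    with r show ?thesis by simp
  qed (use assms less in auto)
qed

lemma le_window_max: "t \<le> s \<Longrightarrow> y s $ i \<le> window_max d y t"
  by (rule bounded_above_from) (auto intro: window_max_ge)

lemma ge_window_min: "t \<le> s \<Longrightarrow> window_min d y t \<le> y s $ i"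
  using delayed_averaging.bounded_above_from[OF neg, of t "- window_min d y t" s i]
  by (auto intro: window_min_le)

lemma window_max_antimono: "t \<le> s \<Longrightarrow> window_max d y s \<le> window_max d y t"
  by (rule window_max_le) (auto intro: le_window_max)

lemma window_min_mono: "t \<le> s \<Longrightarrow> window_min d y t \<le> window_min d y s"
  by (rule window_min_ge) (auto intro: ge_window_min)

lemma spread_antimono: "t \<le> s \<Longrightarrow> spread d y s \<le> spread d y t"
  using window_max_antimono window_min_mono unfolding spread_def by (intro diff_mono) auto

text \<open>Each step gives an agent at least the weight \<mu> on its own current value, so it keeps
  at least the fraction \<mu> of its gap.\<close>

lemma persistent_gap:
  assumes "\<And>s j. t \<le> s \<Longrightarrow> y s $ j \<le> U" and "t \<le> s" "y (d + s) $ i \<le> U - c" "0 \<le> c"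
  shows "y (d + (s + r)) $ i \<le> U - \<mu> ^ r * c"
proof (induction r)
  case (Suc r)
  have "y (Suc (d + (s + r))) $ i \<le> U - \<mu> * (\<mu> ^ r * c)"
    by (rule step_gap[where \<tau> = 0 and j = i])
      (use Suc assms diag mu_pos in \<open>auto\<close>)
  then show ?case by (simp add: mult.assoc)
qed (use assms in auto)

lemma mu_power_mono: "a \<le> b \<Longrightarrow> \<mu> ^ b \<le> \<mu> ^ a"
  using mu_pos mu_le_1 by (intro power_decreasing) auto

lemma persistent_gap':
  assumes "\<And>s j. t \<le> s \<Longrightarrow> y s $ j \<le> U" and "t \<le> s" "y (d + s) $ i \<le> U - c" "0 \<le> c"
    and "s \<le> s'" "s' \<le> s + H"
  shows "y (d + s') $ i \<le> U - \<mu> ^ H * c"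
proof -
  have "y (d + (s + (s' - s))) $ i \<le> U - \<mu> ^ (s' - s) * c"
    using assms by (intro persistent_gap) auto
  moreover have "\<mu> ^ H * c \<le> \<mu> ^ (s' - s) * c"
    using assms by (intro mult_right_mono mu_power_mono) auto
  ultimately show ?thesis using assms by simp
qed

text \<open>The factor is deliberately smaller than \<open>\<mu> ^ H\<close>: it is the one obtained
  when a gap passes over a link, so that old and new members of a set share one gap fraction after
  the block.\<close>

lemma block_persistent_gap:
  assumes "\<And>s j. t \<le> s \<Longrightarrow> y s $ j \<le> U" and "t \<le> s" "y (d + s) $ i \<le> U - c" "0 \<le> c"
    and "0 \<le> \<beta>" "\<beta> \<le> 1"
  shows "y (d + (s + H)) $ i \<le> U - \<beta> * \<mu> ^ (2 * H) * c"
proof -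
  have "y (d + (s + H)) $ i \<le> U - \<mu> ^ H * c"
    using assms by (intro persistent_gap'[where s = s]) auto
  moreover have "\<beta> * \<mu> ^ (2 * H) * c \<le> 1 * \<mu> ^ H * c"
    using assms mu_pos by (intro mult_right_mono mult_mono mu_power_mono) auto
  ultimately show ?thesis by simp
qed

text \<open>The window of the links starts \<open>d\<close> steps late so that all delayed values used
  by the link already carry the gap.\<close>

lemma block_spreading_gap:
  assumes U: "\<And>s j. t \<le> s \<Longrightarrow> y s $ j \<le> U" and "t \<le> s" "y (d + s) $ j \<le> U - c" "0 \<le> c"
    and "0 \<le> \<beta>"
    and H: "H = Suc (d + L)"
    and big: "real (L * Suc d) * \<beta> < (\<Sum>k = s + d + 1..s + d + L. \<Sum>\<tau>\<le>d. A \<tau> k $ i $ j)"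
  shows "y (d + (s + H)) $ i \<le> U - \<beta> * \<mu> ^ (2 * H) * c"
proof -
  \<comment> \<open>Pigeonhole: the sum has \<open>L * Suc d\<close> terms, so one of them exceeds
    \<beta>.\<close>
  obtain k \<tau> where k: "s + d + 1 \<le> k" "k \<le> s + d + L" and \<tau>: "\<tau> \<le> d" and b: "\<beta> < A \<tau> k $ i $ j"
  proof (rule ccontr)
    assume "\<not> thesis"
    then have "(\<Sum>k = s + d + 1..s + d + L. \<Sum>\<tau>\<le>d. A \<tau> k $ i $ j)
        \<le> (\<Sum>k = s + d + 1..s + d + L. \<Sum>\<tau>\<le>d. \<beta>)"
      using that by (intro sum_mono) (auto simp: not_less[symmetric])
    with big show False by (simp add: algebra_simps)
  qed
  \<comment> \<open>Here \<open>k - \<tau> \<ge> s + 1\<close>, so agent \<open>j\<close> has the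
    gap at the delayed time. One factor \<open>\<mu> ^ H\<close> carries it there; a second one
    carries the gap of \<open>i\<close> from \<open>Suc k\<close> to the end of the block, and
    \<open>H = Suc (d + L)\<close> just leaves room for the latest link.\<close>
  have "y (d + (k - \<tau>)) $ j \<le> U - \<mu> ^ H * c"
    using assms k \<tau> by (intro persistent_gap'[where s = s]) auto
  then have "y (Suc (d + k)) $ i \<le> U - \<beta> * (\<mu> ^ H * c)"
    using k \<tau> b assms mu_pos by (intro step_gap[where \<tau> = \<tau> and j = j]) auto
  then have "y (d + Suc k) $ i \<le> U - \<beta> * (\<mu> ^ H * c)" by simp
  then have "y (d + (s + H)) $ i \<le> U - \<mu> ^ H * (\<beta> * (\<mu> ^ H * c))"
    using k assms mu_pos by (intro persistent_gap'[where s = "Suc k"]) auto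
  then show ?thesis unfolding mult_2 power_add by (simp add: mult_ac)
qed

text \<open>The hypothesis concerns only the latest entry of a window. After \<open>d\<close>
  further steps every entry of the window is \<open>y (d + s')\<close> with
  \<open>s \<le> s' \<le> s + d\<close>, so each carries the gap up to the factor
  \<open>\<mu> ^ d\<close>.\<close>

lemma window_max_gap:
  assumes "\<And>s j. t \<le> s \<Longrightarrow> y s $ j \<le> U" and "t \<le> s" "\<And>i. y (d + s) $ i \<le> U - c" "0 \<le> c"
  shows "window_max d y (s + d) \<le> U - \<mu> ^ d * c"
proof (rule window_max_le)
  fix r i assume r: "s + d \<le> r" "r \<le> d + (s + d)"
  have "y (d + (r - d)) $ i \<le> U - \<mu> ^ d * c"
    using assms r by (intro persistent_gap'[where s = s]) auto
  with r show "y r $ i \<le> U - \<mu> ^ d * c" by simp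
qed

lemma window_min_gap:
  assumes "\<And>s j. t \<le> s \<Longrightarrow> V \<le> y s $ j" and "t \<le> s" "\<And>i. V + c \<le> y (d + s) $ i" "0 \<le> c"
  shows "V + \<mu> ^ d * c \<le> window_min d y (s + d)"
proof (rule window_min_ge)
  fix r i assume r: "s + d \<le> r" "r \<le> d + (s + d)"
  interpret N: delayed_averaging A d \<mu> "\<lambda>s. - y s" by (rule neg)
  have "(- y (d + (r - d))) $ i \<le> - V - \<mu> ^ d * c"
    by (rule N.persistent_gap'[where s = s and t = t]) (use assms r in \<open>auto simp: algebra_simps\<close>)
  with r show "V + \<mu> ^ d * c \<le> y r $ i" by simp
qed

text \<open>The window maximum decreases and is bounded below, hence converges. A vanishing spread
  forces the minimum to the same limit, and every coordinate is squeezed between them.\<close>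

lemma consensus_of_spread:
  assumes "(\<lambda>t. spread d y t) \<longlonglongrightarrow> 0"
  shows "\<exists>\<alpha>. y \<longlonglongrightarrow> \<alpha> *\<^sub>R 1"
proof -
  have bdd: "window_min d y 0 \<le> window_max d y t" for t
    using window_min_mono[of 0 t] spread_nonneg[of d y t] by (simp add: spread_def)
  have "decseq (window_max d y)" by (simp add: decseq_def window_max_antimono)
  with bdd obtain \<alpha> where \<alpha>: "window_max d y \<longlonglongrightarrow> \<alpha>"
    using decseq_convergent by metis
  have min: "window_min d y \<longlonglongrightarrow> \<alpha>"
    using tendsto_diff[OF \<alpha> assms] by (simp add: spread_def)
  have "(\<lambda>t. y t $ i) \<longlonglongrightarrow> \<alpha>" for i
    by (rule tendsto_sandwich[OF _ _ min \<alpha>]) (auto intro!: always_eventually window_min_le window_max_ge)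
  then have "y \<longlonglongrightarrow> \<alpha> *\<^sub>R 1"
    by (intro vec_tendstoI) simp
  then show ?thesis ..
qed

end

section \<open>Low and high agents relative to a reference window\<close>

definition low :: "nat \<Rightarrow> (nat \<Rightarrow> real ^ 'n) \<Rightarrow> nat \<Rightarrow> real \<Rightarrow> nat \<Rightarrow> 'n \<Rightarrow> bool" where
  "low d y n c s i \<longleftrightarrow> y (d + s) $ i \<le> window_max d y n - c * spread d y n"

text \<open>As in \<open>low\<close>, the extremes and the spread are frozen at the reference time
  \<open>n\<close>, and only the current state at the later time \<open>s\<close> is tested against
  them.\<close>

definition high :: "nat \<Rightarrow> (nat \<Rightarrow> real ^ 'n) \<Rightarrow> nat \<Rightarrow> real \<Rightarrow> nat \<Rightarrow> 'n \<Rightarrow> bool" where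
  "high d y n c s i \<longleftrightarrow> window_min d y n + c * spread d y n \<le> y (d + s) $ i"

definition settled :: "nat \<Rightarrow> (nat \<Rightarrow> real ^ 'n) \<Rightarrow> nat \<Rightarrow> real \<Rightarrow> nat \<Rightarrow> bool" where
  "settled d y n c s \<longleftrightarrow> (\<forall>i. low d y n c s i) \<or> (\<forall>i. high d y n c s i)"

text \<open>An agent that is both low and high counts twice. The count is a progress measure: it is
  at least \<open>CARD('n)\<close> once every agent is in one of the sets, and never exceeds
  \<open>2 * CARD('n)\<close>.\<close>

definition gap_count :: "nat \<Rightarrow> (nat \<Rightarrow> real ^ 'n) \<Rightarrow> nat \<Rightarrow> real \<Rightarrow> nat \<Rightarrow> nat" where
  "gap_count d y n c s =
    (\<Sum>i\<in>UNIV. (if low d y n c s i then 1 else 0) + (if high d y n c s i then 1 else 0))"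

text \<open>The index order is that of matrix entries: a link from \<open>j\<close> to
  \<open>i\<close> leaves one of the two sets.\<close>

definition boundary :: "nat \<Rightarrow> (nat \<Rightarrow> real ^ 'n) \<Rightarrow> nat \<Rightarrow> real \<Rightarrow> nat \<Rightarrow> 'n \<Rightarrow> 'n \<Rightarrow> bool" where
  "boundary d y n c s i j \<longleftrightarrow>
    low d y n c s j \<and> \<not> low d y n c s i \<or> high d y n c s j \<and> \<not> high d y n c s i"

lemma settled_of_gap_count:
  fixes y :: "nat \<Rightarrow> real ^ 'n"
  assumes "2 * CARD('n) \<le> gap_count d y n c s"
  shows "settled d y n c s"
proof (rule ccontr)
  assume "\<not> ?thesis"
  then obtain i where "\<not> low d y n c s i" by (auto simp: settled_def)
  then have "gap_count d y n c s < (\<Sum>i\<in>(UNIV :: 'n set). 2)"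
    unfolding gap_count_def by (intro sum_strict_mono_ex1) auto
  with assms show False by simp
qed

lemma boundary_of_spanning_tree:
  assumes "has_spanning_tree E" "\<not> settled d y n c s"
    and "\<And>i. low d y n c s i \<or> high d y n c s i"
  shows "\<exists>(j, i)\<in>E. boundary d y n c s i j"
  using spanning_tree_leaves_cover[of E "{i. low d y n c s i}" "{i. high d y n c s i}"] assms
  unfolding boundary_def settled_def by auto

context delayed_averaging
begin

text \<open>The fraction 1/2 puts both thresholds at the midpoint of the two extremes, and every
  value lies on one side of it.\<close>

lemma low_or_high: "low d y n (1 / 2) n i \<or> high d y n (1 / 2) n i"
  unfolding low_def high_def spread_def by (simp add: field_simps) argo

lemma gap_nonneg: "0 \<le> c \<Longrightarrow> 0 \<le> c * spread d y n"
  by (simp add: spread_nonneg)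

lemma low_persists:
  assumes "low d y n c s i" "n \<le> s" "0 \<le> c" "0 \<le> \<beta>" "\<beta> \<le> 1"
  shows "low d y n (\<beta> * \<mu> ^ (2 * H) * c) (s + H) i"
  using block_persistent_gap[where t = n and U = "window_max d y n" and s = s and i = i
      and c = "c * spread d y n" and \<beta> = \<beta> and H = H] assms gap_nonneg le_window_max
  unfolding low_def by (simp add: mult.assoc)

lemma high_persists:
  assumes "high d y n c s i" "n \<le> s" "0 \<le> c" "0 \<le> \<beta>" "\<beta> \<le> 1"
  shows "high d y n (\<beta> * \<mu> ^ (2 * H) * c) (s + H) i"
  using delayed_averaging.block_persistent_gap[OF neg, where t = n and U = "- window_min d y n" and s = s and i = i
      and c = "c * spread d y n" and \<beta> = \<beta> and H = H] assms gap_nonneg ge_window_min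
  unfolding high_def by (simp add: mult.assoc)

lemma low_spreads:
  assumes "low d y n c s j" "n \<le> s" "0 \<le> c" "0 \<le> \<beta>"
    and "real (L * Suc d) * \<beta> < (\<Sum>k = s + d + 1..s + d + L. \<Sum>\<tau>\<le>d. A \<tau> k $ i $ j)"
  shows "low d y n (\<beta> * \<mu> ^ (2 * Suc (d + L)) * c) (s + Suc (d + L)) i"
  using block_spreading_gap[where t = n and U = "window_max d y n" and s = s and i = i and j = j
      and c = "c * spread d y n" and \<beta> = \<beta> and L = L] assms gap_nonneg le_window_max
  unfolding low_def by (simp add: mult.assoc)

lemma high_spreads:
  assumes "high d y n c s j" "n \<le> s" "0 \<le> c" "0 \<le> \<beta>"
    and "real (L * Suc d) * \<beta> < (\<Sum>k = s + d + 1..s + d + L. \<Sum>\<tau>\<le>d. A \<tau> k $ i $ j)"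
  shows "high d y n (\<beta> * \<mu> ^ (2 * Suc (d + L)) * c) (s + Suc (d + L)) i"
  using delayed_averaging.block_spreading_gap[OF neg, where t = n and U = "- window_min d y n" and s = s and i = i and j = j
      and c = "c * spread d y n" and \<beta> = \<beta> and L = L] assms gap_nonneg ge_window_min
  unfolding high_def by (simp add: mult.assoc)

lemma settled_persists:
  assumes "settled d y n c s" "n \<le> s" "0 \<le> c" "0 \<le> \<beta>" "\<beta> \<le> 1"
  shows "settled d y n (\<beta> * \<mu> ^ (2 * H) * c) (s + H)"
  using assms low_persists high_persists unfolding settled_def by blast

text \<open>No agent leaves a set when the fraction shrinks along the block, while a strong link
  across the boundary makes its target \<open>i\<close> join a set it was not in.\<close>

lemma gap_count_grows:
  assumes "boundary d y n c s i j" "n \<le> s" "0 \<le> c" "0 \<le> \<beta>" "\<beta> \<le> 1"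
    and "real (L * Suc d) * \<beta> < (\<Sum>k = s + d + 1..s + d + L. \<Sum>\<tau>\<le>d. A \<tau> k $ i $ j)"
  shows "gap_count d y n c s < gap_count d y n (\<beta> * \<mu> ^ (2 * Suc (d + L)) * c) (s + Suc (d + L))"
  unfolding gap_count_def
proof (rule sum_strict_mono_ex1)
  note grow = low_persists[OF _ assms(2-5)] high_persists[OF _ assms(2-5)]
    low_spreads[OF _ assms(2-4,6)] high_spreads[OF _ assms(2-4,6)]
  let ?f = "\<lambda>c s i. (if low d y n c s i then 1 else 0) + (if high d y n c s i then 1 else 0) :: nat"
  let ?c = "\<beta> * \<mu> ^ (2 * Suc (d + L)) * c" and ?s = "s + Suc (d + L)"
  show "\<forall>i\<in>UNIV. ?f c s i \<le> ?f ?c ?s i"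
    using grow(1,2)[of _ "Suc (d + L)"] by auto
  have "?f c s i < ?f ?c ?s i"
    using assms(1) grow(1,2)[of i "Suc (d + L)"] grow(3,4) unfolding boundary_def by auto
  then show "\<exists>i\<in>UNIV. ?f c s i < ?f ?c ?s i" by blast
qed auto

text \<open>If all agents are low, the maximum drops by a fixed part of the spread while the minimum
  cannot decrease; if all are high, the roles are exchanged.\<close>

lemma spread_contracts:
  assumes "settled d y n c s" "n \<le> s" "0 \<le> c"
  shows "spread d y (s + d) \<le> (1 - \<mu> ^ d * c) * spread d y n"
  using assms(1) unfolding settled_def
proof
  assume "\<forall>i. low d y n c s i"
  then have "window_max d y (s + d) \<le> window_max d y n - \<mu> ^ d * (c * spread d y n)"
    using assms by (intro window_max_gap[where t = n]) (auto simp: low_def le_window_max gap_nonneg)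
  moreover have "window_min d y n \<le> window_min d y (s + d)"
    using assms by (intro window_min_mono) auto
  ultimately show ?thesis by (simp add: spread_def algebra_simps)
next
  assume "\<forall>i. high d y n c s i"
  then have "window_min d y n + \<mu> ^ d * (c * spread d y n) \<le> window_min d y (s + d)"
    using assms by (intro window_min_gap[where t = n]) (auto simp: high_def ge_window_min gap_nonneg)
  moreover have "window_max d y (s + d) \<le> window_max d y n"
    using assms by (intro window_max_antimono) auto
  ultimately show ?thesis by (simp add: spread_def algebra_simps)
qed

end

subsection \<open>Contraction in expectation\<close>

lemma borel_measurable_vec_entry[measurable (raw)]:
  fixes f :: "'a \<Rightarrow> 'b :: {second_countable_topology, real_normed_vector} ^ 'n"
  assumes "f \<in> borel_measurable M"
  shows "(\<lambda>x. f x $ i) \<in> borel_measurable M"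
  by (rule measurable_compose[OF assms])
    (intro borel_measurable_continuous_onI continuous_intros)

text \<open>Summing over all links in \<open>b\<close> avoids a measurable choice of one link. The total weight \<open>Y\<close>
  of these links is bounded and has conditional expectation at least \<open>\<delta>\<close> where \<open>Z\<close> is nonzero,
  so \<open>Y \<ge> \<delta> / 2\<close> with conditional probability bounded below.\<close>

lemma (in prob_space) boundary_weight_bound:
  fixes W :: "'a \<Rightarrow> real ^ 'n ^ 'n" and b :: "'n \<Rightarrow> 'n \<Rightarrow> 'a \<Rightarrow> bool"
  assumes sub: "subalgebra M F"
    and W[measurable]: "W \<in> borel_measurable M"
    and W_nonneg: "\<And>\<omega> i j. \<omega> \<in> space M \<Longrightarrow> 0 \<le> W \<omega> $ i $ j"
    and W_row: "\<And>\<omega> i. \<omega> \<in> space M \<Longrightarrow> (\<Sum>j\<in>UNIV. W \<omega> $ i $ j) \<le> C"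
    and Z[measurable]: "Z \<in> borel_measurable F"
    and Z01: "\<And>\<omega>. \<omega> \<in> space M \<Longrightarrow> 0 \<le> Z \<omega> \<and> Z \<omega> \<le> 1"
    and b[measurable]: "\<And>i j. Measurable.pred F (b i j)"
    and tree: "AE \<omega> in M. has_spanning_tree (delta_graph \<delta> (matrix_cond_exp M F W \<omega>))"
    and cross: "\<And>\<omega> E. \<omega> \<in> space M \<Longrightarrow> Z \<omega> \<noteq> 0 \<Longrightarrow> has_spanning_tree E \<Longrightarrow> \<exists>(j, i)\<in>E. b i j \<omega>"
    and \<delta>: "\<delta> > 0"
  shows "\<delta> / 2 * (\<integral>\<omega>. Z \<omega> \<partial>M) \<le> C * CARD('n) *
    (\<integral>\<omega>. (if \<delta> / 2 \<le> (\<Sum>i\<in>UNIV. \<Sum>j\<in>UNIV. if b i j \<omega> then W \<omega> $ i $ j else 0) then Z \<omega> else 0) \<partial>M)"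
proof -
  interpret sub: finite_measure_subalgebra M F
    by unfold_locales (rule sub)
  note from_sub[measurable] = measurable_from_subalg[OF sub Z] measurable_from_subalg[OF sub b]
  have entry[measurable]: "(\<lambda>\<omega>. W \<omega> $ i $ j) \<in> borel_measurable M" for i j
    by measurable
  have entry_le: "W \<omega> $ i $ j \<le> C" if "\<omega> \<in> space M" for \<omega> i j
    using member_le_sum[of j UNIV "\<lambda>j. W \<omega> $ i $ j"] W_nonneg W_row that
    by (meson UNIV_I finite order_trans)
  have intW: "integrable M (\<lambda>\<omega>. W \<omega> $ i $ j)" for i j
    by (rule integrable_const_bound[where B = C]) (use W_nonneg entry_le in auto)
  have intZ: "integrable M Z"
    by (rule integrable_const_bound[where B = 1]) (use Z01 in auto)
  define R where "R i j = real_cond_exp M F (\<lambda>\<omega>. W \<omega> $ i $ j)" for i j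
  define Zb where "Zb i j \<omega> = (if b i j \<omega> then Z \<omega> else 0)" for i j \<omega>
  have Zb[measurable]: "Zb i j \<in> borel_measurable F" for i j
    unfolding Zb_def by measurable
  have ZbM[measurable]: "Zb i j \<in> borel_measurable M" for i j
    by (rule measurable_from_subalg[OF sub Zb])
  have Zb01: "0 \<le> Zb i j \<omega> \<and> Zb i j \<omega> \<le> 1" if "\<omega> \<in> space M" for i j \<omega>
    using Z01[OF that] by (auto simp: Zb_def)
  have intZW: "integrable M (\<lambda>\<omega>. Zb i j \<omega> * W \<omega> $ i $ j)" for i j
  proof (rule integrable_const_bound[where B = "1 * C"])
    show "AE \<omega> in M. norm (Zb i j \<omega> * W \<omega> $ i $ j) \<le> 1 * C"
    proof (rule AE_I2)
      fix \<omega> assume \<omega>: "\<omega> \<in> space M"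
      show "norm (Zb i j \<omega> * W \<omega> $ i $ j) \<le> 1 * C"
        unfolding norm_mult
        using Zb01[OF \<omega>] W_nonneg[OF \<omega>] entry_le[OF \<omega>] by (intro mult_mono) auto
    qed
  qed measurable
  \<comment> \<open>\<open>Zb i j\<close> is measurable with respect to \<open>F\<close>, so under
    the integral its cofactor may be replaced by the conditional expectation.\<close>
  note R = sub.real_cond_exp_intg[OF intZW Zb entry, folded R_def]
  define Y where "Y \<omega> = (\<Sum>i\<in>UNIV. \<Sum>j\<in>UNIV. if b i j \<omega> then W \<omega> $ i $ j else 0)" for \<omega>
  have Y_le: "Y \<omega> \<le> C * CARD('n)" if "\<omega> \<in> space M" for \<omega>
  proof -
    have "Y \<omega> \<le> (\<Sum>i\<in>(UNIV :: 'n set). \<Sum>j\<in>UNIV. W \<omega> $ i $ j)"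
      unfolding Y_def using W_nonneg[OF that] by (intro sum_mono) auto
    also have "\<dots> \<le> (\<Sum>i\<in>(UNIV :: 'n set). C)"
      using W_row[OF that] by (intro sum_mono)
    finally show ?thesis by (simp add: mult.commute)
  qed
  have ZY: "Z \<omega> * Y \<omega> = (\<Sum>i\<in>UNIV. \<Sum>j\<in>UNIV. Zb i j \<omega> * W \<omega> $ i $ j)" for \<omega>
    by (auto simp: Y_def Zb_def sum_distrib_left intro!: sum.cong)
  have R_nonneg: "AE \<omega> in M. \<forall>i j. 0 \<le> R i j \<omega>"
    unfolding AE_all_countable R_def using W_nonneg by (intro allI sub.real_cond_exp_pos) auto
  \<comment> \<open>Where \<open>Z\<close> is nonzero, the tree of the conditional expectation has a
    link in \<open>b\<close>, whose term alone is at least \<open>\<delta> * Z\<close>; all other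
    terms are nonnegative.\<close>
  have "AE \<omega> in M. \<delta> * Z \<omega> \<le> (\<Sum>i\<in>UNIV. \<Sum>j\<in>UNIV. Zb i j \<omega> * R i j \<omega>)"
    using R_nonneg tree AE_space
  proof eventually_elim
    case (elim \<omega>)
    have pos: "0 \<le> Zb i j \<omega> * R i j \<omega>" for i j
      using elim Zb01 by simp
    show ?case
    proof (cases "Z \<omega> = 0")
      case False
      then obtain i j where ij: "b i j \<omega>" "\<delta> \<le> R i j \<omega>"
        using cross[OF elim(3) False elim(2)] \<delta>
        by (auto simp: delta_graph_eq matrix_cond_exp_def R_def)
      have "\<delta> * Z \<omega> \<le> Zb i j \<omega> * R i j \<omega>"
        using ij Z01[OF elim(3)] mult_right_mono[of \<delta> "R i j \<omega>" "Z \<omega>"] by (simp add: Zb_def mult.commute)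
      also have "\<dots> \<le> (\<Sum>j\<in>UNIV. Zb i j \<omega> * R i j \<omega>)"
        using pos by (intro member_le_sum) auto
      also have "\<dots> \<le> (\<Sum>i\<in>UNIV. \<Sum>j\<in>UNIV. Zb i j \<omega> * R i j \<omega>)"
        using pos by (intro member_le_sum[where f = "\<lambda>i. \<Sum>j\<in>UNIV. Zb i j \<omega> * R i j \<omega>"] sum_nonneg) auto
      finally show ?thesis .
    qed (use pos in \<open>auto intro!: sum_nonneg\<close>)
  qed
  then have "(\<integral>\<omega>. \<delta> * Z \<omega> \<partial>M) \<le> (\<integral>\<omega>. (\<Sum>i\<in>UNIV. \<Sum>j\<in>UNIV. Zb i j \<omega> * R i j \<omega>) \<partial>M)"
    using intZ R(1) by (intro integral_mono_AE) auto
  also have "\<dots> = (\<integral>\<omega>. Z \<omega> * Y \<omega> \<partial>M)"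
    unfolding ZY using R intZW by (simp add: Bochner_Integration.integral_sum)
  \<comment> \<open>Split at the threshold \<open>\<delta> / 2\<close>: above it \<open>Y\<close> is
    at most \<open>C * CARD('n)\<close>, below it at most \<open>\<delta> / 2\<close>. The latter
    contribution is finally absorbed by half of the left-hand side.\<close>
  also have "\<dots> \<le> (\<integral>\<omega>. \<delta> / 2 * Z \<omega> + C * CARD('n) * (if \<delta> / 2 \<le> Y \<omega> then Z \<omega> else 0) \<partial>M)"
  proof (rule integral_mono)
    show "integrable M (\<lambda>\<omega>. Z \<omega> * Y \<omega>)"
      unfolding ZY using intZW by auto
    have "integrable M (\<lambda>\<omega>. if \<delta> / 2 \<le> Y \<omega> then Z \<omega> else 0)"
      unfolding Y_def
      by (rule integrable_const_bound[where B = 1]) (use Z01 in auto)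
    then show "integrable M (\<lambda>\<omega>. \<delta> / 2 * Z \<omega> + C * CARD('n) * (if \<delta> / 2 \<le> Y \<omega> then Z \<omega> else 0))"
      using intZ by simp
    fix \<omega> assume \<omega>: "\<omega> \<in> space M"
    show "Z \<omega> * Y \<omega> \<le> \<delta> / 2 * Z \<omega> + C * CARD('n) * (if \<delta> / 2 \<le> Y \<omega> then Z \<omega> else 0)"
    proof (cases "\<delta> / 2 \<le> Y \<omega>")
      case True
      have "Z \<omega> * Y \<omega> \<le> Z \<omega> * (C * CARD('n))" 
        using Y_le[OF \<omega>] Z01[OF \<omega>] by (intro mult_left_mono) auto
      moreover have "0 \<le> \<delta> / 2 * Z \<omega>" using \<delta> Z01[OF \<omega>] by simp
      ultimately show ?thesis using True by (simp add: mult_ac)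
    next
      case False
      then have "Z \<omega> * Y \<omega> \<le> Z \<omega> * (\<delta> / 2)"
        using Z01[OF \<omega>] by (intro mult_left_mono) auto
      then show ?thesis using False by (simp add: mult_ac)
    qed
  qed
  also have "\<dots> = \<delta> / 2 * (\<integral>\<omega>. Z \<omega> \<partial>M) + C * CARD('n) * (\<integral>\<omega>. (if \<delta> / 2 \<le> Y \<omega> then Z \<omega> else 0) \<partial>M)"
  proof -
    have "integrable M (\<lambda>\<omega>. if \<delta> / 2 \<le> Y \<omega> then Z \<omega> else 0)"
      unfolding Y_def
      by (rule integrable_const_bound[where B = 1]) (use Z01 in auto)
    then show ?thesis using intZ by simp
  qed
  finally show ?thesis by (simp add: Y_def)
qed

section \<open>Random trajectories and measurability of the two sets\<close>

locale random_averaging = prob_space M for M :: "'a measure" +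
  fixes F :: "nat \<Rightarrow> 'a measure" and A :: "nat \<Rightarrow> nat \<Rightarrow> 'a \<Rightarrow> real ^ 'n ^ 'n"
    and d :: nat and \<mu> :: real and L :: nat and \<delta> :: real and y :: "nat \<Rightarrow> 'a \<Rightarrow> real ^ 'n"
  assumes sub: "subalgebra M (F t)"
    and F_mono: "s \<le> t \<Longrightarrow> sets (F s) \<subseteq> sets (F t)"
    and A_measurable: "\<tau> \<le> d \<Longrightarrow> A \<tau> t \<in> borel_measurable (F t)"
    and averaging: "\<omega> \<in> space M \<Longrightarrow> delayed_averaging (\<lambda>\<tau> t. A \<tau> t \<omega>) d \<mu> (\<lambda>s. y s \<omega>)"
    and init_measurable: "s \<le> d \<Longrightarrow> (\<lambda>\<omega>. y s \<omega> $ i) \<in> borel_measurable (F 0)"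
    and init_bounds: "s \<le> d \<Longrightarrow> \<omega> \<in> space M \<Longrightarrow> 0 \<le> y s \<omega> $ i \<and> y s \<omega> $ i \<le> 1"
    and L_pos: "0 < L" and delta_pos: "0 < \<delta>"
    and tree: "AE \<omega> in M. \<forall>n\<ge>1. has_spanning_tree (delta_graph \<delta>
      (matrix_cond_exp M (F n) (\<lambda>\<omega>'. \<Sum>k=n+1..n+L. \<Sum>\<tau>\<le>d. A \<tau> k \<omega>') \<omega>))"
begin

lemma mu_pos: "0 < \<mu>" and mu_le_1: "\<mu> \<le> 1"
proof -
  obtain \<omega> where "\<omega> \<in> space M" using not_empty by auto
  then interpret delayed_averaging "\<lambda>\<tau> t. A \<tau> t \<omega>" d \<mu> "\<lambda>s. y s \<omega>" by (rule averaging)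
  show "0 < \<mu>" "\<mu> \<le> 1" by (rule mu_pos mu_le_1)+
qed

lemma space_F: "space (F t) = space M"
  using sub by (simp add: subalgebra_def)

lemma measurable_F_mono: "f \<in> measurable (F s) N \<Longrightarrow> s \<le> t \<Longrightarrow> f \<in> measurable (F t) N"
  using F_mono[of s t] space_F[of s] space_F[of t] unfolding measurable_def by auto

lemma measurable_F_M: "f \<in> measurable (F s) N \<Longrightarrow> f \<in> measurable M N"
  by (rule measurable_from_subalg[OF sub])

lemma y_measurable: "s \<le> d + t \<Longrightarrow> (\<lambda>\<omega>. y s \<omega> $ i) \<in> borel_measurable (F t)"
proof (induction t arbitrary: s i)
  case 0
  then show ?case by (simp add: init_measurable)
next
  case (Suc t)
  have old[measurable]: "(\<lambda>\<omega>. y s \<omega> $ i) \<in> borel_measurable (F (Suc t))" if "s \<le> d + t" for s i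
    using Suc.IH[OF that] by (rule measurable_F_mono) simp
  have A[measurable]: "A \<tau> t \<in> borel_measurable (F (Suc t))" if "\<tau> \<le> d" for \<tau>
    using A_measurable[OF that] by (rule measurable_F_mono) simp
  show ?case
  proof (cases "s = Suc (d + t)")
    case True
    have "(\<lambda>\<omega>. \<Sum>\<tau>\<le>d. \<Sum>j\<in>UNIV. A \<tau> t \<omega> $ i $ j * y (d + t - \<tau>) \<omega> $ j) \<in> borel_measurable (F (Suc t))"
      by (intro borel_measurable_sum borel_measurable_times borel_measurable_vec_entry A old) auto
    then show ?thesis
      using delayed_averaging.rec[OF averaging]
      by (subst measurable_cong[where g = "\<lambda>\<omega>. \<Sum>\<tau>\<le>d. \<Sum>j\<in>UNIV. A \<tau> t \<omega> $ i $ j * y (d + t - \<tau>) \<omega> $ j"])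
        (auto simp: True space_F)
  qed (use Suc old in auto)
qed

lemma window_max_measurable: "(\<lambda>\<omega>. window_max d (\<lambda>s. y s \<omega>) t) \<in> borel_measurable (F t)"
  unfolding window_max_def by (intro borel_measurable_Max) (auto intro!: y_measurable)

lemma window_min_measurable: "(\<lambda>\<omega>. window_min d (\<lambda>s. y s \<omega>) t) \<in> borel_measurable (F t)"
  unfolding window_min_def by (intro borel_measurable_Min) (auto intro!: y_measurable)

definition D :: "nat \<Rightarrow> 'a \<Rightarrow> real" where
  "D t \<omega> = spread d (\<lambda>s. y s \<omega>) t"

lemma D_measurable: "D t \<in> borel_measurable (F t)"
  unfolding D_def spread_def
  by (intro borel_measurable_diff window_max_measurable window_min_measurable)

lemma D_measurable_M[measurable]: "D t \<in> borel_measurable M"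
  by (rule measurable_F_M[OF D_measurable])

lemma D_nonneg: "0 \<le> D t \<omega>"
  by (simp add: D_def spread_nonneg)

lemma D_antimono: "\<omega> \<in> space M \<Longrightarrow> s \<le> t \<Longrightarrow> D t \<omega> \<le> D s \<omega>"
  unfolding D_def by (rule delayed_averaging.spread_antimono[OF averaging])

text \<open>Initial data in \<open>[0, 1]\<close> make the constant 1 an integrable bound for all
  spreads.\<close>

lemma D_le_1: 
  assumes "\<omega> \<in> space M"
  shows "D t \<omega> \<le> 1"
proof -
  have "window_max d (\<lambda>s. y s \<omega>) 0 \<le> 1" "0 \<le> window_min d (\<lambda>s. y s \<omega>) 0"
    using init_bounds assms by (auto intro!: window_max_le window_min_ge)
  then have "D 0 \<omega> \<le> 1" by (simp add: D_def spread_def)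
  with D_antimono[OF assms, of 0 t] show ?thesis by simp
qed

lemma integrable_restricted_D:
  assumes [measurable]: "Measurable.pred M P"
  shows "integrable M (\<lambda>\<omega>. if P \<omega> then D t \<omega> else 0)"
  by (rule integrable_const_bound[where B = 1]) (use D_nonneg D_le_1 in auto)

lemma integrable_D: "integrable M (D t)"
  using integrable_restricted_D[of "\<lambda>_. True" t] by simp

lemma low_measurable:
  assumes "n \<le> s"
  shows "Measurable.pred (F s) (\<lambda>\<omega>. low d (\<lambda>s. y s \<omega>) n c s i)"
proof -
  have [measurable]: "(\<lambda>\<omega>. window_max d (\<lambda>s. y s \<omega>) n) \<in> borel_measurable (F s)"
      "(\<lambda>\<omega>. spread d (\<lambda>s. y s \<omega>) n) \<in> borel_measurable (F s)"
    using window_max_measurable D_measurable[unfolded D_def] assms by (auto intro: measurable_F_mono)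
  have [measurable]: "(\<lambda>\<omega>. y (d + s) \<omega> $ i) \<in> borel_measurable (F s)"
    by (rule y_measurable) simp
  show ?thesis unfolding low_def by measurable
qed

lemma high_measurable:
  assumes "n \<le> s"
  shows "Measurable.pred (F s) (\<lambda>\<omega>. high d (\<lambda>s. y s \<omega>) n c s i)"
proof -
  have [measurable]: "(\<lambda>\<omega>. window_min d (\<lambda>s. y s \<omega>) n) \<in> borel_measurable (F s)"
      "(\<lambda>\<omega>. spread d (\<lambda>s. y s \<omega>) n) \<in> borel_measurable (F s)"
    using window_min_measurable D_measurable[unfolded D_def] assms by (auto intro: measurable_F_mono)
  have [measurable]: "(\<lambda>\<omega>. y (d + s) \<omega> $ i) \<in> borel_measurable (F s)"
    by (rule y_measurable) simp
  show ?thesis unfolding high_def by measurable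
qed

text \<open>The time is \<open>s\<close>, the gap fraction is \<open>c\<close>, and \<open>k\<close> is the number of successful blocks.\<close>

definition reached :: "nat \<Rightarrow> real \<Rightarrow> nat \<Rightarrow> nat \<Rightarrow> 'a \<Rightarrow> bool" where
  "reached n c s k \<omega> \<longleftrightarrow> (\<forall>i. low d (\<lambda>s. y s \<omega>) n c s i \<or> high d (\<lambda>s. y s \<omega>) n c s i) \<and>
    (settled d (\<lambda>s. y s \<omega>) n c s \<or> CARD('n) + k \<le> gap_count d (\<lambda>s. y s \<omega>) n c s)"

lemma settled_measurable:
  assumes "n \<le> s"
  shows "Measurable.pred (F s) (\<lambda>\<omega>. settled d (\<lambda>s. y s \<omega>) n c s)"
  using low_measurable[OF assms, measurable] high_measurable[OF assms, measurable]
  unfolding settled_def by measurable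

lemma reached_measurable:
  assumes "n \<le> s"
  shows "Measurable.pred (F s) (reached n c s k)"
proof -
  note [measurable] = low_measurable[OF assms] high_measurable[OF assms] settled_measurable[OF assms]
  show ?thesis unfolding reached_def gap_count_def by measurable
qed

text \<open>If the links leaving the two sets carry total weight at least \<open>\<delta> / 2\<close>, one of them has a
  single delayed weight above \<open>\<beta>\<close>; each block shrinks the gap fraction by \<open>\<gamma>\<close>, and \<open>p\<close> bounds the
  conditional probability of that event.\<close>

definition \<beta> :: real where
  "\<beta> = min 1 (\<delta> / (4 * (real CARD('n) * real CARD('n)) * real (L * Suc d)))"

definition \<gamma> :: real where
  "\<gamma> = \<beta> * \<mu> ^ (2 * Suc (d + L))"

definition p :: real where
  "p = min 1 (\<delta> / (2 * real L * real CARD('n)))"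

section \<open>Growth of the low and high sets from block to block\<close>

lemma beta: "0 < \<beta>" "\<beta> \<le> 1"
  using delta_pos L_pos unfolding \<beta>_def by (auto intro!: divide_pos_pos mult_pos_pos simp del: of_nat_mult of_nat_Suc)

lemma gamma: "0 < \<gamma>" "\<gamma> \<le> 1"
proof -
  show "0 < \<gamma>" using beta mu_pos by (simp add: \<gamma>_def)
  have "\<beta> * \<mu> ^ (2 * Suc (d + L)) \<le> 1 * 1"
    using beta mu_pos mu_le_1 by (intro mult_mono power_le_one) auto
  then show "\<gamma> \<le> 1" by (simp add: \<gamma>_def)
qed

lemma p: "0 < p" "p \<le> 1"
  using delta_pos L_pos by (auto simp: p_def)

lemma reached_start: "\<omega> \<in> space M \<Longrightarrow> reached n (1 / 2) n 0 \<omega>"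
proof -
  assume "\<omega> \<in> space M"
  then have cover: "low d (\<lambda>s. y s \<omega>) n (1 / 2) n i \<or> high d (\<lambda>s. y s \<omega>) n (1 / 2) n i" for i
    by (rule delayed_averaging.low_or_high[OF averaging])
  then have "(\<Sum>i\<in>(UNIV :: 'n set). 1) \<le> gap_count d (\<lambda>s. y s \<omega>) n (1 / 2) n"
    unfolding gap_count_def by (intro sum_mono) auto
  with cover show ?thesis by (simp add: reached_def)
qed

text \<open>Once settled, the condition on the count is void, so the number \<open>k'\<close> of
  successes may be arbitrary.\<close>

lemma reached_persists_settled:
  assumes "\<omega> \<in> space M" "n \<le> s" "0 \<le> c" "reached n c s k \<omega>" "settled d (\<lambda>s. y s \<omega>) n c s"
  shows "reached n (\<gamma> * c) (s + Suc (d + L)) k' \<omega>"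
proof -
  interpret det: delayed_averaging "\<lambda>\<tau> t. A \<tau> t \<omega>" d \<mu> "\<lambda>s. y s \<omega>"
    by (rule averaging) fact
  note beta' = less_imp_le[OF beta(1)] beta(2)
  show ?thesis
    using assms(4) det.settled_persists[OF assms(5,2,3) beta'] det.low_persists[OF _ assms(2,3) beta']
      det.high_persists[OF _ assms(2,3) beta']
    unfolding reached_def \<gamma>_def by blast
qed

lemma reached_grows:
  assumes "\<omega> \<in> space M" "n \<le> s" "0 \<le> c" "reached n c s k \<omega>" "\<not> settled d (\<lambda>s. y s \<omega>) n c s"
    and big: "\<delta> / 2 \<le> (\<Sum>i\<in>UNIV. \<Sum>j\<in>UNIV. if boundary d (\<lambda>s. y s \<omega>) n c s i j
      then (\<Sum>k = s + d + 1..s + d + L. \<Sum>\<tau>\<le>d. A \<tau> k \<omega>) $ i $ j else 0)"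
  shows "reached n (\<gamma> * c) (s + Suc (d + L)) (Suc k) \<omega>"
proof -
  interpret det: delayed_averaging "\<lambda>\<tau> t. A \<tau> t \<omega>" d \<mu> "\<lambda>s. y s \<omega>"
    by (rule averaging) fact
  obtain i j where ij: "boundary d (\<lambda>s. y s \<omega>) n c s i j"
      "real (L * Suc d) * \<beta> < (\<Sum>k = s + d + 1..s + d + L. \<Sum>\<tau>\<le>d. A \<tau> k \<omega>) $ i $ j"
  \<comment> \<open>If no boundary entry were large, summing over all pairs of agents would give a
    total of at most \<open>\<delta> / 4\<close> by the choice of \<beta>, below the assumed
    \<open>\<delta> / 2\<close>.\<close>
  proof (rule ccontr)
    assume none: "\<not> thesis"
    have "0 \<le> real (L * Suc d) * \<beta>" using beta by simp
    then have "(if boundary d (\<lambda>s. y s \<omega>) n c s i j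
      then (\<Sum>k = s + d + 1..s + d + L. \<Sum>\<tau>\<le>d. A \<tau> k \<omega>) $ i $ j else 0) \<le> real (L * Suc d) * \<beta>" for i j
      using none that by (auto simp: not_less[symmetric])
    then have "\<delta> / 2 \<le> (\<Sum>i\<in>(UNIV :: 'n set). \<Sum>j\<in>(UNIV :: 'n set). real (L * Suc d) * \<beta>)"
      by (intro order.trans[OF big] sum_mono)
    also have "\<dots> = real CARD('n) * real CARD('n) * real (L * Suc d) * \<beta>"
      by (simp add: mult_ac)
    also have "\<dots> \<le> real CARD('n) * real CARD('n) * real (L * Suc d) *
        (\<delta> / (4 * (real CARD('n) * real CARD('n)) * real (L * Suc d)))"
      by (intro mult_left_mono) (auto simp: \<beta>_def)
    also have "\<dots> = \<delta> / 4"
    proof -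
      have *: "m * q * (\<delta> / (4 * m * q)) = \<delta> / 4" if "0 < m" "0 < q" for m q :: real
        using that by simp
      show ?thesis
        by (rule *) (use L_pos in \<open>auto intro!: add_pos_nonneg\<close>)
    qed
    finally show False using delta_pos by simp
  qed
  have "gap_count d (\<lambda>s. y s \<omega>) n c s < gap_count d (\<lambda>s. y s \<omega>) n (\<gamma> * c) (s + Suc (d + L))"
    unfolding \<gamma>_def using ij assms beta by (intro det.gap_count_grows) auto
  then have "CARD('n) + Suc k \<le> gap_count d (\<lambda>s. y s \<omega>) n (\<gamma> * c) (s + Suc (d + L))"
    using assms(4,5) by (simp add: reached_def)
  moreover have "low d (\<lambda>s. y s \<omega>) n (\<gamma> * c) (s + Suc (d + L)) i \<or>
      high d (\<lambda>s. y s \<omega>) n (\<gamma> * c) (s + Suc (d + L)) i" for i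
    using assms(2,3,4) det.low_persists det.high_persists less_imp_le[OF beta(1)] beta(2)
    unfolding reached_def \<gamma>_def by blast
  ultimately show ?thesis
    unfolding reached_def by blast
qed

text \<open>The event is split by \<open>settled\<close>: the settled part survives the block
  surely, the rest gains a success with conditional probability at least \<open>p\<close>. Weighting
  by \<open>D n\<close> lets the blocks be chained without conditional probabilities.\<close>

lemma reached_step:
  assumes "1 \<le> n" "n \<le> s" "0 \<le> c"
  shows "p * (\<integral>\<omega>. (if reached n c s k \<omega> then D n \<omega> else 0) \<partial>M)
    \<le> (\<integral>\<omega>. (if reached n (\<gamma> * c) (s + Suc (d + L)) (Suc k) \<omega> then D n \<omega> else 0) \<partial>M)"
proof -
  define q where "q \<omega> = settled d (\<lambda>s. y s \<omega>) n c s" for \<omega>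
  define r where "r \<omega> = reached n c s k \<omega>" for \<omega>
  define r' where "r' \<omega> = reached n (\<gamma> * c) (s + Suc (d + L)) (Suc k) \<omega>" for \<omega>
  define b where "b i j \<omega> = boundary d (\<lambda>s. y s \<omega>) n c s i j" for i j \<omega>
  define W where "W \<omega> = (\<Sum>k = s + d + 1..s + d + L. \<Sum>\<tau>\<le>d. A \<tau> k \<omega>)" for \<omega>
  define Z where "Z \<omega> = (if r \<omega> \<and> \<not> q \<omega> then D n \<omega> else 0)" for \<omega>
  define h where "h \<omega> = (\<delta> / 2 \<le> (\<Sum>i\<in>UNIV. \<Sum>j\<in>UNIV. if b i j \<omega> then W \<omega> $ i $ j else 0))" for \<omega>
  \<comment> \<open>Conditioning takes place at time \<open>s + d\<close>, because the links that a
    block uses are those from \<open>s + d + 1\<close> on.\<close>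
  have qF: "Measurable.pred (F (s + d)) q" and rF: "Measurable.pred (F (s + d)) r"
    and DF: "D n \<in> borel_measurable (F (s + d))"
    unfolding q_def[abs_def] r_def[abs_def]
    by (rule measurable_F_mono[OF settled_measurable] measurable_F_mono[OF reached_measurable]
        measurable_F_mono[OF D_measurable]; use assms in simp)+
  have bF: "Measurable.pred (F (s + d)) (b i j)" for i j
  proof -
    have "Measurable.pred (F s) (b i j)"
      using low_measurable[OF assms(2), measurable] high_measurable[OF assms(2), measurable]
      unfolding b_def[abs_def] boundary_def by measurable
    then show ?thesis by (rule measurable_F_mono) simp
  qed
  have ZF: "Z \<in> borel_measurable (F (s + d))"
    using qF[measurable] rF[measurable] DF[measurable] unfolding Z_def[abs_def] by measurable
  note [measurable] = measurable_F_M[OF qF] measurable_F_M[OF rF] measurable_F_M[OF bF] measurable_F_M[OF ZF]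
  have [measurable]: "Measurable.pred M r'"
    unfolding r'_def[abs_def] using assms by (intro measurable_F_M[OF reached_measurable]) auto
  have [measurable]: "W \<in> borel_measurable M"
    unfolding W_def[abs_def] using A_measurable by (intro borel_measurable_sum) (auto intro: measurable_F_M)
  have hM[measurable]: "Measurable.pred M h"
    unfolding h_def[abs_def] by measurable
  have "\<delta> / 2 * (\<integral>\<omega>. Z \<omega> \<partial>M) \<le> real L * CARD('n) * (\<integral>\<omega>. (if h \<omega> then Z \<omega> else 0) \<partial>M)"
    unfolding h_def
  proof (rule boundary_weight_bound[OF sub _ _ _ ZF _ bF])
    show "AE \<omega> in M. has_spanning_tree (delta_graph \<delta> (matrix_cond_exp M (F (s + d)) W \<omega>))"
      using tree assms unfolding W_def[abs_def] by (auto elim!: eventually_mono)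
    fix \<omega> assume \<omega>: "\<omega> \<in> space M"
    interpret det: delayed_averaging "\<lambda>\<tau> t. A \<tau> t \<omega>" d \<mu> "\<lambda>s. y s \<omega>"
      by (rule averaging) fact
    show "0 \<le> W \<omega> $ i $ j" for i j
      unfolding W_def by (auto intro!: sum_nonneg det.nonneg)
    have "(\<Sum>j\<in>UNIV. W \<omega> $ i $ j) = (\<Sum>k = s + d + 1..s + d + L. \<Sum>\<tau>\<le>d. \<Sum>j\<in>UNIV. A \<tau> k \<omega> $ i $ j)" for i
    proof -
      have "(\<Sum>j\<in>UNIV. W \<omega> $ i $ j) = (\<Sum>k = s + d + 1..s + d + L. \<Sum>j\<in>UNIV. \<Sum>\<tau>\<le>d. A \<tau> k \<omega> $ i $ j)"
        unfolding W_def sum_component by (rule sum.swap)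
      also have "\<dots> = (\<Sum>k = s + d + 1..s + d + L. \<Sum>\<tau>\<le>d. \<Sum>j\<in>UNIV. A \<tau> k \<omega> $ i $ j)"
        by (intro sum.cong refl sum.swap)
      finally show ?thesis .
    qed
    then show "(\<Sum>j\<in>UNIV. W \<omega> $ i $ j) \<le> real L" for i
      by (simp add: det.row_sum)
    show "0 \<le> Z \<omega> \<and> Z \<omega> \<le> 1"
      using D_nonneg D_le_1[OF \<omega>] by (simp add: Z_def)
    fix E :: "'n rel" assume "Z \<omega> \<noteq> 0" "has_spanning_tree E"
    then show "\<exists>(j, i)\<in>E. b i j \<omega>"
      unfolding b_def by (intro boundary_of_spanning_tree)
        (auto simp: Z_def q_def r_def reached_def split: if_splits)
  qed (use delta_pos in simp_all)
  \<comment> \<open>Each row of \<open>W\<close> sums to \<open>L\<close>, which makes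
    \<open>L * CARD('n)\<close> the bound on the total weight; dividing by it produces the constant
    in \<open>p\<close>.\<close>
  then have "(\<delta> / (2 * real L * CARD('n))) * (\<integral>\<omega>. Z \<omega> \<partial>M) \<le> (\<integral>\<omega>. (if h \<omega> then Z \<omega> else 0) \<partial>M)"
    using L_pos by (simp add: field_simps)
  moreover have "0 \<le> (\<integral>\<omega>. Z \<omega> \<partial>M)"
    by (intro integral_nonneg_AE AE_I2) (simp add: Z_def D_nonneg)
  then have "p * (\<integral>\<omega>. Z \<omega> \<partial>M) \<le> (\<delta> / (2 * real L * CARD('n))) * (\<integral>\<omega>. Z \<omega> \<partial>M)"
    by (intro mult_right_mono) (simp_all add: p_def)
  ultimately have grow: "p * (\<integral>\<omega>. Z \<omega> \<partial>M) \<le> (\<integral>\<omega>. (if h \<omega> then Z \<omega> else 0) \<partial>M)"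
    by simp
  define T where "T \<omega> = (if r \<omega> \<and> q \<omega> then D n \<omega> else 0)" for \<omega>
  have intT: "integrable M T" and intZ: "integrable M Z"
    unfolding T_def[abs_def] Z_def[abs_def] by (intro integrable_restricted_D; measurable)+
  have intZh: "integrable M (\<lambda>\<omega>. if h \<omega> then Z \<omega> else 0)"
    using integrable_restricted_D[of "\<lambda>\<omega>. h \<omega> \<and> r \<omega> \<and> \<not> q \<omega>" n]
    by (simp add: Z_def if_conn cong: if_cong)
  have "p * (\<integral>\<omega>. T \<omega> \<partial>M) \<le> 1 * (\<integral>\<omega>. T \<omega> \<partial>M)"
    using p by (intro mult_right_mono integral_nonneg_AE AE_I2) (auto simp: T_def D_nonneg)
  with grow have "p * ((\<integral>\<omega>. T \<omega> \<partial>M) + (\<integral>\<omega>. Z \<omega> \<partial>M)) \<le> (\<integral>\<omega>. T \<omega> \<partial>M) + (\<integral>\<omega>. (if h \<omega> then Z \<omega> else 0) \<partial>M)"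
    by (simp add: distrib_left)
  also have "\<dots> = (\<integral>\<omega>. T \<omega> + (if h \<omega> then Z \<omega> else 0) \<partial>M)"
    using intT intZh by simp
  also have "\<dots> \<le> (\<integral>\<omega>. (if r' \<omega> then D n \<omega> else 0) \<partial>M)"
  proof (rule integral_mono)
    fix \<omega> assume \<omega>: "\<omega> \<in> space M"
    \<comment> \<open>The two summands live on the disjoint events settled and unsettled, and each
      event, the second one together with \<open>h\<close>, leads to \<open>r'\<close>.\<close>
    have "r' \<omega>" if "r \<omega>" "q \<omega> \<or> h \<omega>"
      using that reached_persists_settled[OF \<omega>, of n s c k "Suc k"] reached_grows[OF \<omega>, of n s c k] assms
      unfolding r_def r'_def q_def h_def W_def b_def by blast
    then show "T \<omega> + (if h \<omega> then Z \<omega> else 0) \<le> (if r' \<omega> then D n \<omega> else 0)"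
      using D_nonneg[of n \<omega>] by (auto simp: T_def Z_def)
  qed (auto intro!: integrable_restricted_D Bochner_Integration.integrable_add intT intZh)
  also have "(\<integral>\<omega>. T \<omega> \<partial>M) + (\<integral>\<omega>. Z \<omega> \<partial>M) = (\<integral>\<omega>. T \<omega> + Z \<omega> \<partial>M)"
    using intT intZ by simp
  also have "\<dots> = (\<integral>\<omega>. (if r \<omega> then D n \<omega> else 0) \<partial>M)"
    by (intro Bochner_Integration.integral_cong) (auto simp: T_def Z_def)
  finally show ?thesis by (simp add: r_def r'_def)
qed

section \<open>Geometric decay of the expected spread\<close>

lemma reached_lower_bound:
  assumes "1 \<le> n"
  shows "p ^ k * (\<integral>\<omega>. D n \<omega> \<partial>M)
    \<le> (\<integral>\<omega>. (if reached n (\<gamma> ^ k * (1 / 2)) (n + k * Suc (d + L)) k \<omega> then D n \<omega> else 0) \<partial>M)"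
proof (induction k)
  case 0
  have "(\<integral>\<omega>. D n \<omega> \<partial>M) = (\<integral>\<omega>. (if reached n (1 / 2) n 0 \<omega> then D n \<omega> else 0) \<partial>M)"
    using reached_start by (intro Bochner_Integration.integral_cong) auto
  then show ?case by simp
next
  case (Suc k)
  have "p ^ Suc k * (\<integral>\<omega>. D n \<omega> \<partial>M) = p * (p ^ k * (\<integral>\<omega>. D n \<omega> \<partial>M))" by simp
  also have "\<dots> \<le> p * (\<integral>\<omega>. (if reached n (\<gamma> ^ k * (1 / 2)) (n + k * Suc (d + L)) k \<omega> then D n \<omega> else 0) \<partial>M)"
    using Suc p by (intro mult_left_mono) auto
  also have "\<dots> \<le> (\<integral>\<omega>. (if reached n (\<gamma> * (\<gamma> ^ k * (1 / 2))) (n + k * Suc (d + L) + Suc (d + L)) (Suc k) \<omega> then D n \<omega> else 0) \<partial>M)"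
    using assms gamma by (intro reached_step) auto
  also have "n + k * Suc (d + L) + Suc (d + L) = n + Suc k * Suc (d + L)" by simp
  finally show ?case by (simp only: power_Suc mult.assoc)
qed

text \<open>\<open>CARD('n)\<close> blocks serve for the successes, and \<open>d\<close> more steps
  refill the window. The spread contracts on the event \<open>r\<close> and does not increase off
  it.\<close>

lemma expected_contraction:
  assumes "1 \<le> n"
  shows "(\<integral>\<omega>. D (n + (CARD('n) * Suc (d + L) + d)) \<omega> \<partial>M)
    \<le> (1 - \<mu> ^ d * (\<gamma> ^ CARD('n) * (1 / 2)) * p ^ CARD('n)) * (\<integral>\<omega>. D n \<omega> \<partial>M)"
proof -
  define s where "s = n + CARD('n) * Suc (d + L)"
  define c where "c = \<gamma> ^ CARD('n) * (1 / 2)"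
  define r where "r \<omega> = reached n c s (CARD('n)) \<omega>" for \<omega>
  have [measurable]: "Measurable.pred M r"
    unfolding r_def[abs_def] by (rule measurable_F_M[OF reached_measurable]) (simp add: s_def)
  have c: "0 \<le> c" using gamma by (simp add: c_def)
  note intr = integrable_restricted_D[of r n]
  have "(\<integral>\<omega>. D (s + d) \<omega> \<partial>M) \<le> (\<integral>\<omega>. D n \<omega> - \<mu> ^ d * c * (if r \<omega> then D n \<omega> else 0) \<partial>M)"
  proof (rule integral_mono)
    fix \<omega> assume \<omega>: "\<omega> \<in> space M"
    show "D (s + d) \<omega> \<le> D n \<omega> - \<mu> ^ d * c * (if r \<omega> then D n \<omega> else 0)"
    proof (cases "r \<omega>")
      case True
      \<comment> \<open>The count starts at \<open>CARD('n)\<close>, so \<open>CARD('n)\<close>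
        successes bring it to its maximum unless the sets settled earlier.\<close>
      then have "settled d (\<lambda>s. y s \<omega>) n c s"
        unfolding r_def reached_def using settled_of_gap_count[of d "\<lambda>s. y s \<omega>" n c s] by auto
      then have "D (s + d) \<omega> \<le> (1 - \<mu> ^ d * c) * D n \<omega>"
        unfolding D_def using c
        by (intro delayed_averaging.spread_contracts[OF averaging[OF \<omega>]]) (auto simp: s_def)
      with True show ?thesis by (simp add: algebra_simps)
    qed (use D_antimono[OF \<omega>, of n "s + d"] in \<open>simp add: s_def\<close>)
  qed (use integrable_D intr in auto)
  also have "\<dots> = (\<integral>\<omega>. D n \<omega> \<partial>M) - \<mu> ^ d * c * (\<integral>\<omega>. (if r \<omega> then D n \<omega> else 0) \<partial>M)"
    using integrable_D intr by simp
  also have "\<dots> \<le> (\<integral>\<omega>. D n \<omega> \<partial>M) - \<mu> ^ d * c * (p ^ CARD('n) * (\<integral>\<omega>. D n \<omega> \<partial>M))"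
    using reached_lower_bound[OF assms, of "CARD('n)"] c mu_pos
    unfolding r_def c_def s_def by (intro diff_left_mono mult_left_mono) auto
  finally show ?thesis
    by (simp add: s_def c_def algebra_simps)
qed

lemma expectation_D_subseq: "\<exists>K. strict_mono K \<and> (\<lambda>k. \<integral>\<omega>. D (K k) \<omega> \<partial>M) \<longlonglongrightarrow> 0"
proof -
  define \<rho> where "\<rho> = 1 - \<mu> ^ d * (\<gamma> ^ CARD('n) * (1 / 2)) * p ^ CARD('n)"
  define N where "N = CARD('n) * Suc (d + L) + d"
  have "\<mu> ^ d * (\<gamma> ^ CARD('n) * (1 / 2)) * p ^ CARD('n) \<le> 1 * (1 * 1) * 1"
    using mu_pos mu_le_1 gamma p by (intro mult_mono power_le_one) auto
  moreover have "0 < \<mu> ^ d * (\<gamma> ^ CARD('n) * (1 / 2)) * p ^ CARD('n)"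
    using mu_pos gamma p by simp
  ultimately have \<rho>: "0 \<le> \<rho>" "\<rho> < 1" by (auto simp: \<rho>_def)
  \<comment> \<open>Cycles of length \<open>N\<close> start at time 1, since the spanning trees are
    assumed for \<open>n \<ge> 1\<close>.\<close>
  have bound: "(\<integral>\<omega>. D (Suc (k * N)) \<omega> \<partial>M) \<le> \<rho> ^ k * (\<integral>\<omega>. D 1 \<omega> \<partial>M)" for k
  proof (induction k)
    case (Suc k)
    have "(\<integral>\<omega>. D (Suc (k * N) + N) \<omega> \<partial>M) \<le> \<rho> * (\<integral>\<omega>. D (Suc (k * N)) \<omega> \<partial>M)"
      unfolding N_def \<rho>_def by (rule expected_contraction) simp
    also have "\<dots> \<le> \<rho> * (\<rho> ^ k * (\<integral>\<omega>. D 1 \<omega> \<partial>M))"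
      using Suc \<rho> by (intro mult_left_mono)
    finally show ?case by (simp add: algebra_simps)
  qed simp
  have lim: "(\<lambda>k. \<rho> ^ k * (\<integral>\<omega>. D 1 \<omega> \<partial>M)) \<longlonglongrightarrow> 0"
    using \<rho> by (auto intro!: tendsto_mult_left_zero LIMSEQ_realpow_zero)
  have "(\<lambda>k. \<integral>\<omega>. D (Suc (k * N)) \<omega> \<partial>M) \<longlonglongrightarrow> 0"
    by (rule tendsto_sandwich[OF _ _ tendsto_const lim])
      (use bound in \<open>auto intro!: always_eventually integral_nonneg_AE AE_I2 D_nonneg\<close>)
  moreover have "strict_mono (\<lambda>k. Suc (k * N))"
    unfolding N_def by (rule strict_monoI) simp
  ultimately show ?thesis by blast
qed

text \<open>Monotonicity gives a pointwise limit \<open>D'\<close>. By dominated convergence its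
  expectation is the limit of the expectations, which is 0 along a subsequence; a nonnegative
  function with integral 0 vanishes almost everywhere.\<close>

lemma D_tendsto_0: "AE \<omega> in M. (\<lambda>t. D t \<omega>) \<longlonglongrightarrow> 0"
proof -
  define D' where "D' \<omega> = lim (\<lambda>t. D t \<omega>)" for \<omega>
  have lim: "(\<lambda>t. D t \<omega>) \<longlonglongrightarrow> D' \<omega>" if "\<omega> \<in> space M" for \<omega>
  proof -
    have "decseq (\<lambda>t. D t \<omega>)" using D_antimono[OF that] by (simp add: decseq_def)
    then have "convergent (\<lambda>t. D t \<omega>)"
      using decseq_convergent[of "\<lambda>t. D t \<omega>" 0] D_nonneg unfolding convergent_def by metis
    then show ?thesis unfolding D'_def by (simp add: convergent_LIMSEQ_iff)
  qed
  have [measurable]: "D' \<in> borel_measurable M"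
    unfolding D'_def[abs_def] by measurable
  have D'_nonneg: "0 \<le> D' \<omega>" if "\<omega> \<in> space M" for \<omega>
    using LIMSEQ_le_const[OF lim[OF that]] D_nonneg by blast
  have "(\<lambda>t. \<integral>\<omega>. D t \<omega> \<partial>M) \<longlonglongrightarrow> (\<integral>\<omega>. D' \<omega> \<partial>M)"
    by (rule integral_dominated_convergence[where w = "\<lambda>_. 1"])
      (use lim D_nonneg D_le_1 in auto)
  moreover obtain K where "strict_mono K" "(\<lambda>k. \<integral>\<omega>. D (K k) \<omega> \<partial>M) \<longlonglongrightarrow> 0"
    using expectation_D_subseq by blast
  ultimately have "(\<integral>\<omega>. D' \<omega> \<partial>M) = 0"
    using LIMSEQ_subseq_LIMSEQ LIMSEQ_unique by (fastforce simp: o_def)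
  moreover have "integrable M D'"
    by (rule integrable_dominated_convergence[where w = "\<lambda>_. 1" and s = D])
      (use lim D_nonneg D_le_1 in auto)
  ultimately have "AE \<omega> in M. D' \<omega> = 0"
    using D'_nonneg by (subst (asm) integral_nonneg_eq_0_iff_AE) auto
  then show ?thesis
    using AE_space by eventually_elim (use lim in metis)
qed

lemma consensus: "AE \<omega> in M. \<exists>\<alpha>. (\<lambda>s. y s \<omega>) \<longlonglongrightarrow> \<alpha> *\<^sub>R 1"
  using D_tendsto_0 AE_space
  by eventually_elim (simp add: D_def delayed_averaging.consensus_of_spread[OF averaging])

end

subsection \<open>Superposition\<close>

text \<open>For \<open>s = Suc (d + t)\<close> the differences \<open>s - Suc d\<close> and
  \<open>s - Suc \<tau>\<close> are \<open>t\<close> and \<open>d + t - \<tau>\<close>, so this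
  solves the shifted recursion with initial window \<open>v\<close>.\<close>

function delayed_solution ::
  "nat \<Rightarrow> (nat \<Rightarrow> nat \<Rightarrow> real ^ 'n ^ 'n) \<Rightarrow> (nat \<Rightarrow> real ^ 'n) \<Rightarrow> nat \<Rightarrow> real ^ 'n" where
  "delayed_solution d A v s = (if s \<le> d then v s
    else (\<chi> i. \<Sum>\<tau>\<le>d. \<Sum>j\<in>UNIV. A \<tau> (s - Suc d) $ i $ j * delayed_solution d A v (s - Suc \<tau>) $ j))"
  by pat_completeness auto
termination
  by (relation "Wellfounded.measure (\<lambda>(d, A, v, s). s)") auto

declare delayed_solution.simps[simp del]

lemma delayed_solution_init: "s \<le> d \<Longrightarrow> delayed_solution d A v s = v s"
  by (simp add: delayed_solution.simps)

lemma delayed_solution_rec: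
  "delayed_solution d A v (Suc (d + t)) $ i =
    (\<Sum>\<tau>\<le>d. \<Sum>j\<in>UNIV. A \<tau> t $ i $ j * delayed_solution d A v (d + t - \<tau>) $ j)"
  by (subst delayed_solution.simps) simp

definition impulse :: "nat \<Rightarrow> 'n \<Rightarrow> nat \<Rightarrow> real ^ 'n" where
  "impulse a k s = (if s = a then axis k 1 else 0)"

text \<open>The right-hand side is the expansion of the initial window in unit impulses. Both sides
  agree on that window and obey the same linear recursion.\<close>

lemma delayed_superposition:
  fixes y :: "nat \<Rightarrow> real ^ 'n"
  assumes rec: "\<And>t i. y (Suc (d + t)) $ i = (\<Sum>\<tau>\<le>d. \<Sum>j\<in>UNIV. A \<tau> t $ i $ j * y (d + t - \<tau>) $ j)"
  shows "y s = (\<Sum>a\<le>d. \<Sum>k\<in>UNIV. y a $ k *\<^sub>R delayed_solution d A (impulse a k) s)"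
proof (induction s rule: less_induct)
  case (less s)
  show ?case
  proof (cases "s \<le> d")
    case True
    have "(\<Sum>a\<le>d. \<Sum>k\<in>UNIV. y a $ k *\<^sub>R delayed_solution d A (impulse a k) s)
        = (\<Sum>a\<le>d. if s = a then \<Sum>k\<in>UNIV. y a $ k *\<^sub>R axis k 1 else 0)"
      using True by (intro sum.cong) (auto simp: delayed_solution_init impulse_def)
    also have "\<dots> = (\<Sum>k\<in>UNIV. y s $ k *s axis k 1)"
      using True by (simp add: scalar_mult_eq_scaleR)
    also have "\<dots> = y s" by (rule basis_expansion)
    finally show ?thesis by simp
  next
    case False
    then obtain t where t: "s = Suc (d + t)"
      by (metis add.commute add_Suc_right less_imp_Suc_add not_le)
    let ?f = "\<lambda>a k. delayed_solution d A (impulse a k)"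
    \<comment> \<open>Double sums become single sums over pairs, so that one exchange of summation
      suffices.\<close>
    have pairs: "(\<Sum>a\<le>d. \<Sum>k\<in>UNIV. g a k) = (\<Sum>q\<in>{..d} \<times> UNIV. g (fst q) (snd q))"
      for g :: "nat \<Rightarrow> 'n \<Rightarrow> real"
      by (simp add: sum.cartesian_product case_prod_unfold)
    have "y s $ i = (\<Sum>a\<le>d. \<Sum>k\<in>UNIV. y a $ k *\<^sub>R ?f a k s) $ i" for i
    proof -
      have "y s $ i = (\<Sum>\<tau>\<le>d. \<Sum>j\<in>UNIV. A \<tau> t $ i $ j * (\<Sum>a\<le>d. \<Sum>k\<in>UNIV. y a $ k * ?f a k (d + t - \<tau>) $ j))"
        unfolding t rec
      proof (intro sum.cong refl)
        fix \<tau> j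
        have "y (d + t - \<tau>) = (\<Sum>a\<le>d. \<Sum>k\<in>UNIV. y a $ k *\<^sub>R ?f a k (d + t - \<tau>))"
          by (rule less) (simp add: t)
        from arg_cong[OF this, of "\<lambda>v. v $ j"]
        have "y (d + t - \<tau>) $ j = (\<Sum>a\<le>d. \<Sum>k\<in>UNIV. y a $ k * ?f a k (d + t - \<tau>) $ j)"
          by (simp only: sum_component vector_scaleR_component real_scaleR_def)
        then show "A \<tau> t $ i $ j * y (d + t - \<tau>) $ j
            = A \<tau> t $ i $ j * (\<Sum>a\<le>d. \<Sum>k\<in>UNIV. y a $ k * ?f a k (d + t - \<tau>) $ j)"
          by (rule arg_cong)
      qed
      also have "\<dots> = (\<Sum>p\<in>{..d}\<times>UNIV. \<Sum>q\<in>{..d}\<times>UNIV. A (fst p) t $ i $ snd p * (y (fst q) $ snd q * ?f (fst q) (snd q) (d + t - fst p) $ snd p))"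
        by (simp only: pairs sum_distrib_left)
      also have "\<dots> = (\<Sum>q\<in>{..d}\<times>UNIV. \<Sum>p\<in>{..d}\<times>UNIV. y (fst q) $ snd q * (A (fst p) t $ i $ snd p * ?f (fst q) (snd q) (d + t - fst p) $ snd p))"
        unfolding mult.left_commute[of "y _ $ _"] by (rule sum.swap)
      also have "\<dots> = (\<Sum>a\<le>d. \<Sum>k\<in>UNIV. y a $ k * ?f a k s $ i)"
        unfolding t delayed_solution_rec
        by (simp only: pairs sum_distrib_left)
      finally show ?thesis by (simp only: sum_component vector_scaleR_component real_scaleR_def)
    qed
    then show ?thesis unfolding vec_eq_iff by blast
  qed
qed

section \<open>Almost sure consensus for arbitrary initial data\<close>

theorem theorem3p2:
  fixes M :: "'a measure" and F :: "nat \<Rightarrow> 'a measure" and S :: "'s measure"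
    and \<sigma> :: "nat \<Rightarrow> 'a \<Rightarrow> 's" and \<tau>M :: nat
    and G :: "nat \<Rightarrow> 's \<Rightarrow> real ^ 'n ^ 'n"
  assumes "prob_space M"
    and "filtration (space M) F"
    and "\<And>t. subalgebra M (F t)"
    and "\<And>t. \<sigma> t \<in> measurable (F t) S"
    and "\<And>\<tau> s. \<tau> \<le> \<tau>M \<Longrightarrow> s \<in> space S \<Longrightarrow> 0 \<le> G \<tau> s"
    and "\<And>\<tau> t. \<tau> \<le> \<tau>M \<Longrightarrow> (\<lambda>\<omega>. G \<tau> (\<sigma> t \<omega>)) \<in> borel_measurable (F t)"
    and "\<And>s. s \<in> space S \<Longrightarrow> stochastic_matrix (\<Sum>\<tau>\<le>\<tau>M. G \<tau> s)"
    and "\<exists>\<mu>>0. \<exists>L>0. \<exists>\<delta>>0.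
      (\<forall>s\<in>space S. mat \<mu> \<le> G 0 s) \<and>
      (AE \<omega> in M. \<forall>n\<ge>1. has_spanning_tree (delta_graph \<delta>
        (matrix_cond_exp M (F n)
          (\<lambda>\<omega>'. \<Sum>k=n+1..n+L. \<Sum>\<tau>\<le>\<tau>M. G \<tau> (\<sigma> k \<omega>')) \<omega>)))"
  shows "reaches_consensus M \<tau>M G \<sigma>"
proof -
  interpret prob_space M by fact
  obtain \<mu> L \<delta> where pos: "\<mu> > 0" "L > 0" "\<delta> > 0"
    and diag: "\<And>s. s \<in> space S \<Longrightarrow> mat \<mu> \<le> G 0 s"
    and tree: "AE \<omega> in M. \<forall>n\<ge>1. has_spanning_tree (delta_graph \<delta>
        (matrix_cond_exp M (F n)
          (\<lambda>\<omega>'. \<Sum>k=n+1..n+L. \<Sum>\<tau>\<le>\<tau>M. G \<tau> (\<sigma> k \<omega>')) \<omega>))"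
    using assms(8) by blast
  define A where "A \<tau> t \<omega> = G \<tau> (\<sigma> t \<omega>)" for \<tau> t \<omega>
  have \<sigma>: "\<sigma> t \<omega> \<in> space S" if "\<omega> \<in> space M" for t \<omega>
    using measurable_space[OF measurable_from_subalg[OF assms(3,4)]] that by blast
  define f where "f a k s \<omega> = delayed_solution \<tau>M (\<lambda>\<tau> t. A \<tau> t \<omega>) (impulse a k) s" for a k s \<omega>
  have "random_averaging M F A \<tau>M \<mu> L \<delta> (f a k)" for a k
  proof (intro random_averaging.intro random_averaging_axioms.intro)
    show "prob_space M" by fact
    show "subalgebra M (F t)" for t by fact
    show "sets (F s) \<subseteq> sets (F t)" if "s \<le> t" for s t
      using filtration.sets_F_mono[OF assms(2)] that by simp
    show "A \<tau> t \<in> borel_measurable (F t)" if "\<tau> \<le> \<tau>M" for \<tau> t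
      using assms(6)[OF that] by (simp add: A_def[abs_def])
    show "0 < L" "0 < \<delta>" by fact+
    show "AE \<omega> in M. \<forall>n\<ge>1. has_spanning_tree (delta_graph \<delta>
      (matrix_cond_exp M (F n) (\<lambda>\<omega>'. \<Sum>k=n+1..n+L. \<Sum>\<tau>\<le>\<tau>M. A \<tau> k \<omega>') \<omega>))"
      using tree by (simp add: A_def)
    \<comment> \<open>An impulse does not depend on \<omega>, so the initial window is constant and
      measurable for \<open>F 0\<close>.\<close>
    show "(\<lambda>\<omega>. f a k s \<omega> $ i) \<in> borel_measurable (F 0)" if "s \<le> \<tau>M" for s i
      using that by (simp add: f_def delayed_solution_init)
    show "0 \<le> f a k s \<omega> $ i \<and> f a k s \<omega> $ i \<le> 1" if "s \<le> \<tau>M" for s \<omega> i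
      using that by (simp add: f_def delayed_solution_init impulse_def axis_def)
    show "delayed_averaging (\<lambda>\<tau> t. A \<tau> t \<omega>) \<tau>M \<mu> (\<lambda>s. f a k s \<omega>)" if \<omega>: "\<omega> \<in> space M" for \<omega>
    proof
      show "0 \<le> A \<tau> t \<omega> $ i $ j" if "\<tau> \<le> \<tau>M" for \<tau> t i j
        using assms(5)[OF that \<sigma>[OF \<omega>]] by (simp add: A_def less_eq_vec_def)
      show "(\<Sum>\<tau>\<le>\<tau>M. \<Sum>j\<in>UNIV. A \<tau> t \<omega> $ i $ j) = 1" for t i
        using assms(7)[OF \<sigma>[OF \<omega>]]
        by (subst sum.swap) (simp add: A_def stochastic_matrix_def)
      show "\<mu> \<le> A 0 t \<omega> $ i $ i" for t i
      proof -
        have "mat \<mu> $ i $ i \<le> G 0 (\<sigma> t \<omega>) $ i $ i"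
          using diag[OF \<sigma>[OF \<omega>]] by (simp add: less_eq_vec_def)
        then show ?thesis by (simp add: A_def mat_def)
      qed
      show "0 < \<mu>" by fact
      show "f a k (Suc (\<tau>M + t)) \<omega> $ i =
          (\<Sum>\<tau>\<le>\<tau>M. \<Sum>j\<in>UNIV. A \<tau> t \<omega> $ i $ j * f a k (\<tau>M + t - \<tau>) \<omega> $ j)" for t i
        by (simp add: f_def delayed_solution_rec)
    qed
  qed
  then have "AE \<omega> in M. \<exists>\<alpha>. (\<lambda>s. f a k s \<omega>) \<longlonglongrightarrow> \<alpha> *\<^sub>R 1" for a k
    by (rule random_averaging.consensus)
  \<comment> \<open>There are countably many impulses, so one null set serves all of them; it is
    independent of the trajectory \<open>x\<close> chosen later.\<close>
  then have basis: "AE \<omega> in M. \<forall>a k. \<exists>\<alpha>. (\<lambda>s. f a k s \<omega>) \<longlonglongrightarrow> \<alpha> *\<^sub>R 1"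
    unfolding AE_all_countable by blast
  show ?thesis
    unfolding reaches_consensus_def
  proof (intro allI impI)
    fix x :: "int \<Rightarrow> 'a \<Rightarrow> real ^ 'n"
    assume sys: "delayed_system M \<tau>M G \<sigma> x"
    show "AE \<omega> in M. \<exists>\<alpha>. (\<lambda>t. x (int t) \<omega>) \<longlonglongrightarrow> \<alpha> *\<^sub>R 1"
      using basis AE_space
    proof eventually_elim
      case (elim \<omega>)
      \<comment> \<open>The shift by \<open>\<tau>M\<close> moves the initial data to the indices
        \<open>0\<close> to \<open>\<tau>M\<close>.\<close>
      define y where "y s = x (int s - int \<tau>M) \<omega>" for s
      have "y (Suc (\<tau>M + t)) $ i
          = (\<Sum>\<tau>\<le>\<tau>M. \<Sum>j\<in>UNIV. A \<tau> t \<omega> $ i $ j * y (\<tau>M + t - \<tau>) $ j)" for t i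
      proof -
        have "y (Suc (\<tau>M + t)) $ i = x (int t + 1) \<omega> $ i"
          by (simp add: y_def add.commute)
        also have "\<dots> = (\<Sum>\<tau>\<le>\<tau>M. \<Sum>j\<in>UNIV. G \<tau> (\<sigma> t \<omega>) $ i $ j * x (int t - int \<tau>) \<omega> $ j)"
          using sys elim(2) unfolding delayed_system_def by blast
        also have "\<dots> = (\<Sum>\<tau>\<le>\<tau>M. \<Sum>j\<in>UNIV. A \<tau> t \<omega> $ i $ j * y (\<tau>M + t - \<tau>) $ j)"
          by (intro sum.cong) (auto simp: A_def y_def of_nat_diff)
        finally show ?thesis .
      qed
      \<comment> \<open>The coefficients \<open>y a $ k\<close> are random, but for fixed \<omega>
        they are plain numbers and superposition applies pointwise.\<close>
      then have y: "y s = (\<Sum>a\<le>\<tau>M. \<Sum>k\<in>UNIV. y a $ k *\<^sub>R f a k s \<omega>)" for s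
        unfolding f_def by (rule delayed_superposition)
      obtain \<alpha> where \<alpha>: "\<And>a k. (\<lambda>s. f a k s \<omega>) \<longlonglongrightarrow> \<alpha> a k *\<^sub>R 1"
        using elim(1) by metis
      have "(\<lambda>s. \<Sum>a\<le>\<tau>M. \<Sum>k\<in>UNIV. y a $ k *\<^sub>R f a k s \<omega>)
          \<longlonglongrightarrow> (\<Sum>a\<le>\<tau>M. \<Sum>k\<in>UNIV. y a $ k *\<^sub>R (\<alpha> a k *\<^sub>R 1))"
        by (intro tendsto_sum tendsto_scaleR tendsto_const \<alpha>)
      then have "y \<longlonglongrightarrow> (\<Sum>a\<le>\<tau>M. \<Sum>k\<in>UNIV. y a $ k * \<alpha> a k) *\<^sub>R 1"
        unfolding y[symmetric] by (simp add: scaleR_sum_left)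
      then have "(\<lambda>t. y (t + \<tau>M)) \<longlonglongrightarrow> (\<Sum>a\<le>\<tau>M. \<Sum>k\<in>UNIV. y a $ k * \<alpha> a k) *\<^sub>R 1"
        by (rule LIMSEQ_ignore_initial_segment)
      then show ?case by (auto simp: y_def)
    qed
  qed
qed

end
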